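(* Let $G$ be a mixed graph on $n$ vertices, let $\boldsymbol{\lambda}_1(G)$ and $\boldsymbol{\lambda}_{2n}(G)$ be the largest and smallest eigenvalues of $\mathcal{I}(G)$, and let $\lambda_1(G_u)$ be the largest eigenvalue of the adjacency matrix $A(G_u)$ of the undirected part $G_u$ of $G$. Then $\frac12\left(\boldsymbol{\lambda}_1(G)+\boldsymbol{\lambda}_{2n}(G)\right)\le\lambda_1(G_u)$.
   Context: A mixed graph $G$ has a finite nonempty vertex set $V_G=\{v_1,\dots,v_n\}$, a finite set $E_G$ of (undirected) edges, each joining an unordered pair of vertices $\{u,v\}$ (a loop if $u=v$), and a finite set $\vec E_G$ of arcs, each going from $u$ to $v$ for an ordered pair $(u,v)$ of vertices (a directed loop if $u=v$); multiple edges, loops, arcs and directed loops are allowed. The undirected part $G_u$ is the graph with vertex set $V_G$ and edge set $E_G$ (arcs removed); its adjacency matrix $A=A(G_u)$ has $A_{ij}$ ($i\neq j$) equal to the number of edges joining $v_i$ and $v_j$, and $A_{ii}$ equal to twice the number of loops at $v_i$. The integrated adjacency matrix $\mathcal{I}(G)$ is the real symmetric $2n\times 2n$ matrix $\begin{bmatrix}A&D\\ D^T&A\end{bmatrix}$, where $D_{ij}$ is the number of arcs from $v_i$ to $v_j$; its eigenvalues are arranged as $\boldsymbol{\lambda}_1(G)\ge\cdots\ge\boldsymbol{\lambda}_{2n}(G)$. *)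

theory Defs
  imports "Jordan_Normal_Form.Char_Poly" "HOL-Library.Multiset"
begin

text \<open>An edge \<open>e\<close> joining \<open>u\<close> and \<open>v\<close> has \<open>ends G e = {u, v}\<close>, so it is a loop iff this set is a
  singleton. Edges and arcs are abstract elements, so multiplicities are numbers of elements with
  the same ends.\<close>

record ('v, 'e) multigraph =
  verts :: "'v set"
  edges :: "'e set"
  ends :: "'e \<Rightarrow> 'v set"

record ('v, 'e, 'a) mixed_graph = "('v, 'e) multigraph" +
  arcs :: "'a set"
  tail :: "'a \<Rightarrow> 'v"
  head :: "'a \<Rightarrow> 'v"

locale multigraph =
  fixes G :: "('v, 'e, 'x) multigraph_scheme"
  assumes finite_verts: "finite (verts G)"
    and verts_nonempty: "verts G \<noteq> {}"
    and finite_edges: "finite (edges G)"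
    and ends_wf: "e \<in> edges G \<Longrightarrow> \<exists>u\<in>verts G. \<exists>v\<in>verts G. ends G e = {u, v}"

locale mixed_graph = multigraph G
  for G :: "('v, 'e, 'a, 'x) mixed_graph_scheme" +
  assumes finite_arcs: "finite (arcs G)"
    and tail_in_verts: "a \<in> arcs G \<Longrightarrow> tail G a \<in> verts G"
    and head_in_verts: "a \<in> arcs G \<Longrightarrow> head G a \<in> verts G"

definition undirected_part :: "('v, 'e, 'a) mixed_graph \<Rightarrow> ('v, 'e) multigraph" where
  "undirected_part G = \<lparr>verts = verts G, edges = edges G, ends = ends G\<rparr>"

text \<open>The list \<open>vs\<close> is the enumeration \<open>v\<^sub>1, \<dots>, v\<^sub>n\<close> of the vertices, with \<open>v\<^sub>i = vs ! (i - 1)\<close>;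
  matrix indices are 0-based.\<close>

definition vertex_enumeration :: "('v, 'e, 'x) multigraph_scheme \<Rightarrow> 'v list \<Rightarrow> bool" where
  "vertex_enumeration G vs \<longleftrightarrow> distinct vs \<and> set vs = verts G"

definition adjacency_matrix :: "('v, 'e) multigraph \<Rightarrow> 'v list \<Rightarrow> real mat" where
  "adjacency_matrix H vs = mat (length vs) (length vs) (\<lambda>(i, j).
     if i = j then 2 * real (card {e \<in> edges H. ends H e = {vs ! i}})
     else real (card {e \<in> edges H. ends H e = {vs ! i, vs ! j}}))"

definition arc_matrix :: "('v, 'e, 'a) mixed_graph \<Rightarrow> 'v list \<Rightarrow> real mat" where
  "arc_matrix G vs = mat (length vs) (length vs) (\<lambda>(i, j).
     real (card {a \<in> arcs G. tail G a = vs ! i \<and> head G a = vs ! j}))"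

definition integrated_adjacency_matrix :: "('v, 'e, 'a) mixed_graph \<Rightarrow> 'v list \<Rightarrow> real mat" where
  "integrated_adjacency_matrix G vs =
     (let A = adjacency_matrix (undirected_part G) vs; D = arc_matrix G vs
      in four_block_mat A D (transpose_mat D) A)"

text \<open>The real eigenvalues in decreasing order, repeated according to algebraic multiplicity;
  \<open>kth_eigenvalue\<close> counts from 1. For a symmetric matrix of size \<open>n\<close> there are \<open>n\<close> of them, see
  \<open>length_eigenvalues_symmetric\<close> below.\<close>

definition eigenvalues_decreasing :: "real mat \<Rightarrow> real list" where
  "eigenvalues_decreasing M = rev (sorted_list_of_multiset (proots (char_poly M)))"

definition kth_eigenvalue :: "nat \<Rightarrow> real mat \<Rightarrow> real" where
  "kth_eigenvalue k M = eigenvalues_decreasing M ! (k - 1)"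

lemma set_eigenvalues_decreasing:
  assumes "M \<in> carrier_mat n n"
  shows "set (eigenvalues_decreasing M) = {k. eigenvalue M k}"
proof -
  have "char_poly M \<noteq> 0"
    using degree_monic_char_poly[OF assms] by auto
  then show ?thesis
    by (simp add: eigenvalues_decreasing_def eigenvalue_root_char_poly[OF assms])
qed

lemma size_proots_real_rooted:
  fixes p :: "real poly"
  assumes "p \<noteq> 0" and "\<And>z. poly (map_poly complex_of_real p) z = 0 \<Longrightarrow> z \<in> \<real>"
  shows "size (proots p) = degree p"
  using assms
proof (induction "degree p" arbitrary: p)
  case 0
  then obtain c where "p = [:c:]" by (metis degree_eq_zeroE)
  then show ?case by simp
next
  case (Suc d)
  let ?c = "map_poly complex_of_real"
  have "degree (?c p) = degree p" by simp
  then have "\<not> constant (poly (?c p))"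
    using Suc.hyps(2) by (simp add: constant_degree)
  then obtain z where z: "poly (?c p) z = 0"
    using fundamental_theorem_of_algebra by blast
  then obtain r where r: "z = complex_of_real r"
    using Suc.prems(2) Reals_cases by blast
  have "poly p r = 0" using z unfolding r by simp
  then obtain q where q: "p = [:- r, 1:] * q"
    by (metis dvdE poly_eq_0_iff_dvd)
  have q0: "q \<noteq> 0" using Suc.prems(1) q by auto
  have deg: "degree p = Suc (degree q)"
    unfolding q using q0 by (subst degree_mult_eq) auto
  have "size (proots q) = degree q"
  proof (rule Suc.hyps(1))
    show "d = degree q" using deg Suc.hyps(2) by simp
    show "z \<in> \<real>" if "poly (?c q) z = 0" for z
    proof (rule Suc.prems(2))
      have "?c p = ?c [:- r, 1:] * ?c q"
        unfolding q by (rule poly_eqI) (simp add: coeff_map_poly coeff_pCons split: nat.split)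
      then show "poly (?c p) z = 0" using that by simp
    qed
  qed (fact q0)
  moreover have "proots p = proots [:- r, 1:] + proots q"
    unfolding q using q0 by (subst proots_mult) auto
  moreover have "size (proots [:- r, 1:]) = 1"
    by (simp add: proots_linear_factor)
  ultimately show ?case using deg by simp
qed

lemma length_eigenvalues_symmetric:
  assumes M: "M \<in> carrier_mat n n" and sym: "transpose_mat M = M"
  shows "length (eigenvalues_decreasing M) = n"
proof -
  let ?C = "map_mat complex_of_real M"
  have C: "?C \<in> carrier_mat n n" using M by simp
  have deg: "degree (char_poly M) = n" and nz: "char_poly M \<noteq> 0"
    using degree_monic_char_poly[OF M] by auto
  have symC: "?C $$ (i, j) = ?C $$ (j, i)" if "i < n" "j < n" for i j
    using that M arg_cong[OF sym, of "\<lambda>B. B $$ (i, j)"] by auto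
  have "z \<in> \<real>" if "poly (map_poly complex_of_real (char_poly M)) z = 0" for z
  proof -
    have "poly (char_poly ?C) z = 0"
      using that by (simp add: of_real_hom.char_poly_hom[OF M])
    then obtain v where v: "v \<in> carrier_vec n" "v \<noteq> 0\<^sub>v n" "?C *\<^sub>v v = z \<cdot>\<^sub>v v"
      using eigenvalue_root_char_poly[OF C] C
      unfolding eigenvalue_def eigenvector_def by auto
    let ?q = "\<Sum>i<n. \<Sum>j<n. cnj (v $ i) * ?C $$ (i, j) * v $ j"
    let ?s = "\<Sum>i<n. cnj (v $ i) * v $ i"
    have row: "(\<Sum>j<n. ?C $$ (i, j) * v $ j) = z * v $ i" if "i < n" for i
      using that C v(1) arg_cong[OF v(3), of "\<lambda>w. w $ i"]
      by (simp add: scalar_prod_def lessThan_atLeast0)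
    have q: "?q = z * ?s"
      by (simp add: sum_distrib_left mult.assoc row flip: sum_distrib_left)
         (simp add: sum_distrib_left mult_ac)
    have "cnj ?q = (\<Sum>i<n. \<Sum>j<n. v $ i * ?C $$ (i, j) * cnj (v $ j))"
      using M by (simp add: cnj_sum)
    also have "\<dots> = (\<Sum>j<n. \<Sum>i<n. v $ i * ?C $$ (i, j) * cnj (v $ j))"
      by (rule sum.swap)
    also have "\<dots> = ?q"
      by (intro sum.cong refl) (use symC in \<open>simp add: mult_ac\<close>)
    finally have q_real: "cnj ?q = ?q" .
    have s: "?s = complex_of_real (\<Sum>i<n. (cmod (v $ i))\<^sup>2)"
      by (simp add: complex_norm_square mult.commute del: of_real_power)
    have "?s \<noteq> 0"
    proof
      assume "?s = 0"
      then have "(\<Sum>i<n. (cmod (v $ i))\<^sup>2) = 0" unfolding s of_real_eq_0_iff .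
      then have "\<forall>i<n. v $ i = 0" by (subst (asm) sum_nonneg_eq_0_iff) auto
      then show False using v(1,2) by auto
    qed
    moreover have "cnj z * ?s = z * ?s"
      using q_real unfolding q s by simp
    ultimately have "cnj z = z" by simp
    then show "z \<in> \<real>" by (simp add: Reals_cnj_iff)
  qed
  from size_proots_real_rooted[OF nz this] deg
  have "size (proots (char_poly M)) = n" by simp
  then show ?thesis
    by (simp add: eigenvalues_decreasing_def flip: size_mset)
qed

end

theory Submission
  imports Defs
begin

text \<open>
  Write \<open>I\<close> for the block matrix with diagonal blocks \<open>A\<close> and off-diagonal blocks \<open>D\<close>, \<open>D\<^sup>T\<close>, and
  take an eigenvector \<open>z = (x, y)\<close> for its largest eigenvalue. The quadratic form of \<open>I\<close> at \<open>(x, y)\<close>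
  is \<open>x\<^sup>T A x + y\<^sup>T A y + 2 x\<^sup>T D y\<close>. Flipping the sign of \<open>y\<close> changes neither the norm nor the first two
  terms, and reverses the cross term. At \<open>(x, y)\<close> the Rayleigh quotient of \<open>I\<close> is the largest
  eigenvalue, and at \<open>(x, -y)\<close> it is at least the smallest one. In the sum of the two relations the
  contribution of the arcs cancels, leaving
  \<open>2 (x\<^sup>T A x + y\<^sup>T A y) \<le> 2 \<lambda>\<^sub>1(A) (x\<^sup>T x + y\<^sup>T y)\<close> as an upper bound
  (\<open>block_extreme_eigenvalues_sum_le\<close>).

  The analytic input is that the extreme eigenvalues of a real symmetric matrix bound its Rayleigh
  quotient (\<open>rayleigh_le_first_eigenvalue\<close>, \<open>last_eigenvalue_le_rayleigh\<close>). It is derived without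
  diagonalisation and without compactness of the sphere: the least upper bound \<open>t\<close> of the
  Rayleigh quotients of \<open>M\<close> makes \<open>t - M\<close> positive semidefinite; if \<open>t\<close> were not an eigenvalue, this
  matrix would be nonsingular, hence bounded below by a positive multiple of the identity
  (\<open>psd_nonsingular_uniformly_positive\<close>), and \<open>t\<close> could be decreased.
\<close>

section \<open>Rayleigh quotients of real symmetric matrices\<close>

lemma scalar_prod_self_nonneg:
  fixes x :: "real vec"
  shows "0 \<le> x \<bullet> x"
  by (simp add: scalar_prod_def sum_nonneg)

lemma scalar_prod_self_pos:
  fixes x :: "real vec"
  assumes "x \<in> carrier_vec n" "x \<noteq> 0\<^sub>v n"
  shows "0 < x \<bullet> x"
proof -
  have "\<exists>i<n. x $ i \<noteq> 0"
    using assms by auto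
  then have "\<exists>i\<in>{0..<n}. 0 < x $ i * x $ i"
    by (auto simp: zero_less_mult_iff linorder_neq_iff)
  then have "0 < (\<Sum>i\<in>{0..<n}. x $ i * x $ i)"
    by (auto intro: sum_pos2)
  then show ?thesis
    using assms(1) by (simp add: scalar_prod_def)
qed

text \<open>
  Entrywise \<open>2 |x\<^sub>i x\<^sub>j| \<le> x\<^sub>i\<^sup>2 + x\<^sub>j\<^sup>2 \<le> 2 x\<^sup>T x\<close>, so the sum of the absolute values of the entries of
  \<open>K\<close> already works as a bound; it is increased by one to make it positive.
\<close>

lemma quadratic_form_bounded:
  fixes K :: "real mat"
  assumes K: "K \<in> carrier_mat n n"
  shows "\<exists>c>0. \<forall>x\<in>carrier_vec n. x \<bullet> (K *\<^sub>v x) \<le> c * (x \<bullet> x)"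
proof -
  define c where "c = (\<Sum>i<n. \<Sum>j<n. \<bar>K $$ (i, j)\<bar>)"
  have c: "c \<ge> 0"
    unfolding c_def by (intro sum_nonneg) auto
  have "x \<bullet> (K *\<^sub>v x) \<le> (c + 1) * (x \<bullet> x)" if x: "x \<in> carrier_vec n" for x
  proof -
    have sq: "x $ i * x $ i \<le> x \<bullet> x" if "i < n" for i
      using x that member_le_sum[of i "{0..<n}" "\<lambda>i. x $ i * x $ i"]
      by (simp add: scalar_prod_def)
    have "K $$ (i, j) * x $ i * x $ j \<le> \<bar>K $$ (i, j)\<bar> * (x \<bullet> x)" if "i < n" "j < n" for i j
    proof -
      have "2 * \<bar>x $ i * x $ j\<bar> \<le> x $ i * x $ i + x $ j * x $ j"
        using sum_squares_bound[of "\<bar>x $ i\<bar>" "\<bar>x $ j\<bar>"]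
        by (simp add: power2_eq_square abs_mult mult.assoc)
      then have "\<bar>x $ i * x $ j\<bar> \<le> x \<bullet> x"
        using sq[OF that(1)] sq[OF that(2)] by linarith
      then have "\<bar>K $$ (i, j)\<bar> * \<bar>x $ i * x $ j\<bar> \<le> \<bar>K $$ (i, j)\<bar> * (x \<bullet> x)"
        by (intro mult_left_mono) auto
      moreover have "K $$ (i, j) * x $ i * x $ j \<le> \<bar>K $$ (i, j)\<bar> * \<bar>x $ i * x $ j\<bar>"
        by (metis abs_ge_self abs_mult mult.assoc)
      ultimately show ?thesis by linarith
    qed
    then have "(\<Sum>i<n. \<Sum>j<n. K $$ (i, j) * x $ i * x $ j) \<le> c * (x \<bullet> x)"
      unfolding c_def sum_distrib_right by (intro sum_mono) auto
    moreover have "x \<bullet> (K *\<^sub>v x) = (\<Sum>i<n. \<Sum>j<n. K $$ (i, j) * x $ i * x $ j)"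
      using K x by (auto simp: scalar_prod_def lessThan_atLeast0 sum_distrib_left mult_ac
          intro!: sum.cong)
    ultimately show ?thesis
      using scalar_prod_self_nonneg[of x] by (simp add: distrib_right)
  qed
  then show ?thesis
    using c by (intro exI[of _ "c + 1"]) auto
qed

lemma symmetric_scalar_prod_swap:
  fixes N :: "real mat"
  assumes N: "N \<in> carrier_mat n n" and sym: "transpose_mat N = N"
    and x: "x \<in> carrier_vec n" and y: "y \<in> carrier_vec n"
  shows "x \<bullet> (N *\<^sub>v y) = y \<bullet> (N *\<^sub>v x)"
  using transpose_vec_mult_scalar[OF N y x] N sym x y
  by (simp add: comm_scalar_prod[of y n "N *\<^sub>v x"])

text \<open>
  Let \<open>K\<close> be the inverse of \<open>N\<close>, with quadratic form at most \<open>c x\<^sup>T x\<close>, and \<open>y = K x\<close>. Semidefiniteness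
  at \<open>x - s y\<close> reads \<open>0 \<le> x\<^sup>T N x - 2 s x\<^sup>T x + s\<^sup>2 x\<^sup>T K x\<close>, because \<open>N y = x\<close>. With \<open>s = 1 / c\<close> the last term
  is at most \<open>s x\<^sup>T x\<close>, which leaves \<open>s x\<^sup>T x \<le> x\<^sup>T N x\<close>.
\<close>

lemma psd_nonsingular_uniformly_positive:
  fixes N :: "real mat"
  assumes N: "N \<in> carrier_mat n n" and sym: "transpose_mat N = N"
    and psd: "\<And>x. x \<in> carrier_vec n \<Longrightarrow> 0 \<le> x \<bullet> (N *\<^sub>v x)"
    and nonsingular: "\<And>x. x \<in> carrier_vec n \<Longrightarrow> N *\<^sub>v x = 0\<^sub>v n \<Longrightarrow> x = 0\<^sub>v n"
  shows "\<exists>e>0. \<forall>x\<in>carrier_vec n. e * (x \<bullet> x) \<le> x \<bullet> (N *\<^sub>v x)"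
proof -
  have "det N \<noteq> 0"
    using nonsingular det_0_iff_vec_prod_zero[OF N] by blast
  from det_non_zero_imp_unit[OF N this, of "()"]
  obtain K where K: "K \<in> carrier_mat n n" and NK: "N * K = 1\<^sub>m n"
    by (auto simp: Units_def ring_mat_def)
  obtain c where c: "c > 0"
    and bound: "\<And>x. x \<in> carrier_vec n \<Longrightarrow> x \<bullet> (K *\<^sub>v x) \<le> c * (x \<bullet> x)"
    using quadratic_form_bounded[OF K] by blast
  have "(1 / c) * (x \<bullet> x) \<le> x \<bullet> (N *\<^sub>v x)" if x: "x \<in> carrier_vec n" for x
  proof -
    define y where "y = K *\<^sub>v x"
    have y: "y \<in> carrier_vec n"
      using K x by (simp add: y_def)
    have Ny: "N *\<^sub>v y = x"
      unfolding y_def using assoc_mult_mat_vec[OF N K x] NK x by simp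
    define z where "z = x - (1 / c) \<cdot>\<^sub>v y"
    have z: "z \<in> carrier_vec n"
      using x y by (simp add: z_def)
    have Nx: "N *\<^sub>v x \<in> carrier_vec n"
      using N x by simp
    have "N *\<^sub>v z = N *\<^sub>v x - (1 / c) \<cdot>\<^sub>v x"
      unfolding z_def using N x y Ny
      by (simp add: mult_minus_distrib_mat_vec[OF N] mult_mat_vec[OF N])
    then have "z \<bullet> (N *\<^sub>v z) = (x - (1 / c) \<cdot>\<^sub>v y) \<bullet> (N *\<^sub>v x - (1 / c) \<cdot>\<^sub>v x)"
      by (simp add: z_def)
    also have "\<dots> = x \<bullet> (N *\<^sub>v x) - (1 / c) * (x \<bullet> x) - (1 / c) * (y \<bullet> (N *\<^sub>v x))
        + (1 / c) * ((1 / c) * (y \<bullet> x))"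
      using x y Nx
      by (simp add: minus_scalar_prod_distrib[of _ n] scalar_prod_minus_distrib[of _ n]
          right_diff_distrib)
    also have "y \<bullet> (N *\<^sub>v x) = x \<bullet> x"
      using symmetric_scalar_prod_swap[OF N sym y x] Ny by simp
    also have "y \<bullet> x = x \<bullet> (K *\<^sub>v x)"
      using comm_scalar_prod[OF y x] by (simp add: y_def)
    finally have "z \<bullet> (N *\<^sub>v z) = x \<bullet> (N *\<^sub>v x) - 2 * ((1 / c) * (x \<bullet> x))
        + (1 / c) * ((1 / c) * (x \<bullet> (K *\<^sub>v x)))"
      by simp
    moreover have "(1 / c) * ((1 / c) * (x \<bullet> (K *\<^sub>v x))) \<le> (1 / c) * (x \<bullet> x)"
    proof -
      have "(1 / c) * (x \<bullet> (K *\<^sub>v x)) \<le> x \<bullet> x"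
        using bound[OF x] c by (simp add: field_simps)
      then show ?thesis
        using c by (intro mult_left_mono) auto
    qed
    ultimately show ?thesis
      using psd[OF z] by linarith
  qed
  then show ?thesis
    using c by (intro exI[of _ "1 / c"]) auto
qed

text \<open>
  The eigenvalue is the infimum of all upper bounds of the Rayleigh quotient. It is itself an upper
  bound, and by uniform positivity a smaller one would exist if it were not an eigenvalue. For
  \<open>n = 0\<close> there is no eigenvalue at all.
\<close>

lemma rayleigh_upper_bound_eigenvalue:
  fixes M :: "real mat"
  assumes M: "M \<in> carrier_mat n n" and sym: "transpose_mat M = M" and n: "n > 0"
  shows "\<exists>t. eigenvalue M t \<and> (\<forall>x\<in>carrier_vec n. x \<bullet> (M *\<^sub>v x) \<le> t * (x \<bullet> x))"
proof -
  define S where "S = {t. \<forall>x\<in>carrier_vec n. x \<bullet> (M *\<^sub>v x) \<le> t * (x \<bullet> x)}"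
  have "S \<noteq> {}"
    using quadratic_form_bounded[OF M] by (auto simp: S_def)
  have bounds: "x \<bullet> (M *\<^sub>v x) / (x \<bullet> x) \<le> t"
    if "t \<in> S" "x \<in> carrier_vec n" "x \<noteq> 0\<^sub>v n" for t x
    using that scalar_prod_self_pos[OF that(2,3)] by (auto simp: S_def field_simps)
  \<comment> \<open>Any single Rayleigh quotient bounds \<open>S\<close> from below; a nonzero vector exists as \<open>n > 0\<close>.\<close>
  have bdd: "bdd_below S"
  proof (rule bdd_belowI)
    show "unit_vec n 0 \<bullet> (M *\<^sub>v unit_vec n 0) / (unit_vec n 0 \<bullet> unit_vec n 0) \<le> t" 
      if "t \<in> S" for t :: real
      using n by (intro bounds[OF that]) (auto simp: unit_vec_nonzero)
  qed
  define t where "t = Inf S"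
  have "t \<in> S"
    unfolding S_def
  proof (intro CollectI ballI)
    fix x :: "real vec"
    assume x: "x \<in> carrier_vec n"
    show "x \<bullet> (M *\<^sub>v x) \<le> t * (x \<bullet> x)"
    proof (cases "x = 0\<^sub>v n")
      case True
      then show ?thesis using M by simp
    next
      case False
      have "x \<bullet> (M *\<^sub>v x) / (x \<bullet> x) \<le> t"
        unfolding t_def by (rule cInf_greatest[OF \<open>S \<noteq> {}\<close>]) (rule bounds[OF _ x False])
      then show ?thesis
        using scalar_prod_self_pos[OF x False] by (simp add: field_simps)
    qed
  qed
  define N where "N = t \<cdot>\<^sub>m 1\<^sub>m n - M"
  have N: "N \<in> carrier_mat n n"
    unfolding N_def using M by (rule minus_carrier_mat)
  have symN: "transpose_mat N = N"
  proof (rule eq_matI)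
    fix i j assume "i < dim_row N" "j < dim_col N"
    then show "transpose_mat N $$ (i, j) = N $$ (i, j)"
      using M arg_cong[OF sym, of "\<lambda>B. B $$ (i, j)"] by (auto simp: N_def)
  qed (use N in auto)
  have Nx: "N *\<^sub>v x = t \<cdot>\<^sub>v x - M *\<^sub>v x" if x: "x \<in> carrier_vec n" for x
  proof -
    have "(t \<cdot>\<^sub>m 1\<^sub>m n) *\<^sub>v x = t \<cdot>\<^sub>v x"
      using x by (intro eq_vecI) auto
    then show ?thesis
      unfolding N_def using M x by (subst minus_mult_distrib_mat_vec[of _ n n]) auto
  qed
  have form: "x \<bullet> (N *\<^sub>v x) = t * (x \<bullet> x) - x \<bullet> (M *\<^sub>v x)" if x: "x \<in> carrier_vec n" for x
    using M x by (simp add: Nx[OF x] scalar_prod_minus_distrib[of _ n])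
  have "eigenvalue M t"
  proof (rule ccontr)
    assume no: "\<not> eigenvalue M t"
    have "\<exists>e>0. \<forall>x\<in>carrier_vec n. e * (x \<bullet> x) \<le> x \<bullet> (N *\<^sub>v x)"
    proof (rule psd_nonsingular_uniformly_positive[OF N symN])
      fix x :: "real vec" assume x: "x \<in> carrier_vec n"
      show "0 \<le> x \<bullet> (N *\<^sub>v x)"
        using \<open>t \<in> S\<close> x by (simp add: form S_def)
      assume 0: "N *\<^sub>v x = 0\<^sub>v n"
      have "M *\<^sub>v x = t \<cdot>\<^sub>v x"
      proof (rule eq_vecI)
        fix i assume i: "i < dim_vec (t \<cdot>\<^sub>v x)"
        then show "(M *\<^sub>v x) $ i = (t \<cdot>\<^sub>v x) $ i"
          using M x arg_cong[OF 0[unfolded Nx[OF x]], of "\<lambda>v. v $ i"] by simp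
      qed (use M x in auto)
      then show "x = 0\<^sub>v n"
        using no M x by (auto simp: eigenvalue_def eigenvector_def)
    qed
    then obtain e where "e > 0" and e: "\<And>x. x \<in> carrier_vec n \<Longrightarrow> e * (x \<bullet> x) \<le> x \<bullet> (N *\<^sub>v x)"
      by blast
    have "t - e \<in> S"
      unfolding S_def using e form by (fastforce simp: left_diff_distrib)
    then have "t \<le> t - e"
      using bdd unfolding t_def by (rule cInf_lower)
    then show False using \<open>e > 0\<close> by simp
  qed
  then show ?thesis
    using \<open>t \<in> S\<close> by (auto simp: S_def)
qed

text \<open>The upper bound for \<open>- M\<close>, whose eigenvalues are the negatives of those of \<open>M\<close>.\<close>

lemma rayleigh_lower_bound_eigenvalue:
  fixes M :: "real mat"
  assumes M: "M \<in> carrier_mat n n" and sym: "transpose_mat M = M" and n: "n > 0"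
  shows "\<exists>t. eigenvalue M t \<and> (\<forall>x\<in>carrier_vec n. t * (x \<bullet> x) \<le> x \<bullet> (M *\<^sub>v x))"
proof -
  have neg: "(- M) *\<^sub>v x = - (M *\<^sub>v x)" if "x \<in> carrier_vec n" for x
    using M that by simp
  have "transpose_mat (- M) = - M"
    by (metis sym transpose_uminus)
  then obtain t where t: "eigenvalue (- M) t"
    and bound: "\<And>x. x \<in> carrier_vec n \<Longrightarrow> x \<bullet> ((- M) *\<^sub>v x) \<le> t * (x \<bullet> x)"
    using rayleigh_upper_bound_eigenvalue[of "- M" n] M n by auto
  obtain v where v: "v \<in> carrier_vec n" "v \<noteq> 0\<^sub>v n" "- (M *\<^sub>v v) = t \<cdot>\<^sub>v v"
    using t M neg by (auto simp: eigenvalue_def eigenvector_def)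
  have "M *\<^sub>v v = (- t) \<cdot>\<^sub>v v"
  proof (rule eq_vecI)
    fix i assume i: "i < dim_vec ((- t) \<cdot>\<^sub>v v)"
    then show "(M *\<^sub>v v) $ i = ((- t) \<cdot>\<^sub>v v) $ i"
      using M v(1) arg_cong[OF v(3), of "\<lambda>v. v $ i"] by simp
  qed (use M v in auto)
  then have "eigenvalue M (- t)"
    using M v by (auto simp: eigenvalue_def eigenvector_def)
  moreover have "- t * (x \<bullet> x) \<le> x \<bullet> (M *\<^sub>v x)" if x: "x \<in> carrier_vec n" for x
    using bound[OF x] M x by (simp add: neg)
  ultimately show ?thesis by blast
qed

lemma first_eigenvalue_is_eigenvalue:
  assumes M: "M \<in> carrier_mat n n" and sym: "transpose_mat M = M" and n: "n > 0"
  shows "eigenvalue M (kth_eigenvalue 1 M)"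
proof -
  have "eigenvalues_decreasing M ! 0 \<in> set (eigenvalues_decreasing M)"
    using length_eigenvalues_symmetric[OF M sym] n by (intro nth_mem) simp
  then show ?thesis
    unfolding set_eigenvalues_decreasing[OF M] by (simp add: kth_eigenvalue_def)
qed

lemma eigenvalue_between_first_and_last:
  assumes M: "M \<in> carrier_mat n n" and sym: "transpose_mat M = M" and t: "eigenvalue M t"
  shows "t \<le> kth_eigenvalue 1 M" and "kth_eigenvalue n M \<le> t"
proof -
  let ?L = "eigenvalues_decreasing M"
  have sorted: "sorted_wrt (\<ge>) ?L"
    unfolding eigenvalues_decreasing_def by (simp add: sorted_wrt_rev)
  have len: "length ?L = n"
    by (rule length_eigenvalues_symmetric[OF M sym])
  have "t \<in> set ?L"
    using t set_eigenvalues_decreasing[OF M] by simp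
  then obtain i where i: "i < n" "?L ! i = t"
    unfolding in_set_conv_nth len by blast
  have "?L ! j \<ge> ?L ! k" if "j \<le> k" "k < n" for j k
    using that sorted_wrt_nth_less[OF sorted, of j k] len by (cases "j = k") auto
  from this[of 0 i] this[of i "n - 1"] i
  show "t \<le> kth_eigenvalue 1 M" "kth_eigenvalue n M \<le> t"
    by (auto simp: kth_eigenvalue_def)
qed

lemma rayleigh_le_first_eigenvalue:
  assumes M: "M \<in> carrier_mat n n" and sym: "transpose_mat M = M"
    and x: "x \<in> carrier_vec n" and n: "n > 0"
  shows "x \<bullet> (M *\<^sub>v x) \<le> kth_eigenvalue 1 M * (x \<bullet> x)"
proof -
  obtain t where "eigenvalue M t" and "x \<bullet> (M *\<^sub>v x) \<le> t * (x \<bullet> x)"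
    using rayleigh_upper_bound_eigenvalue[OF M sym n] x by blast
  moreover have "t * (x \<bullet> x) \<le> kth_eigenvalue 1 M * (x \<bullet> x)"
    by (intro mult_right_mono eigenvalue_between_first_and_last(1)[OF M sym]
        scalar_prod_self_nonneg) fact
  ultimately show ?thesis by linarith
qed

lemma last_eigenvalue_le_rayleigh:
  assumes M: "M \<in> carrier_mat n n" and sym: "transpose_mat M = M"
    and x: "x \<in> carrier_vec n" and n: "n > 0"
  shows "kth_eigenvalue n M * (x \<bullet> x) \<le> x \<bullet> (M *\<^sub>v x)"
proof -
  obtain t where "eigenvalue M t" and "t * (x \<bullet> x) \<le> x \<bullet> (M *\<^sub>v x)"
    using rayleigh_lower_bound_eigenvalue[OF M sym n] x by blast
  moreover have "kth_eigenvalue n M * (x \<bullet> x) \<le> t * (x \<bullet> x)"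
    by (intro mult_right_mono eigenvalue_between_first_and_last(2)[OF M sym]
        scalar_prod_self_nonneg) fact
  ultimately show ?thesis by linarith
qed

section \<open>Extreme eigenvalues of a symmetric block matrix\<close>

text \<open>
  The two off-diagonal blocks contribute \<open>x\<^sup>T D y\<close> and \<open>y\<^sup>T D\<^sup>T x\<close>, which agree. The cross term is odd
  in \<open>y\<close>, and the other terms are even; the sign change below relies on this.
\<close>

lemma block_quadratic_form:
  fixes A D :: "real mat"
  assumes A: "A \<in> carrier_mat n n" and D: "D \<in> carrier_mat n n"
    and x: "x \<in> carrier_vec n" and y: "y \<in> carrier_vec n"
  shows "(x @\<^sub>v y) \<bullet> (four_block_mat A D (transpose_mat D) A *\<^sub>v (x @\<^sub>v y))
    = x \<bullet> (A *\<^sub>v x) + y \<bullet> (A *\<^sub>v y) + 2 * (x \<bullet> (D *\<^sub>v y))"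
proof -
  have D': "transpose_mat D \<in> carrier_mat n n" using D by simp
  have "y \<bullet> (transpose_mat D *\<^sub>v x) = x \<bullet> (D *\<^sub>v y)"
    using transpose_vec_mult_scalar[OF D y x] D x y
    by (simp add: comm_scalar_prod[of y n])
  then show ?thesis
    using A D D' x y
    by (simp add: four_block_mat_mult_vec[OF A D D' A x y] scalar_prod_append[of _ n _ n]
        scalar_prod_add_distrib[of _ n])
qed

text \<open>
  The cross term is eliminated by adding the eigenvalue equation for the largest eigenvalue at
  \<open>(x, y)\<close> to the Rayleigh bound for the smallest eigenvalue at \<open>(x, -y)\<close>.
\<close>

lemma block_extreme_eigenvalues_sum_le:
  fixes A D :: "real mat"
  defines "I \<equiv> four_block_mat A D (transpose_mat D) A"
  assumes A: "A \<in> carrier_mat n n" and symA: "transpose_mat A = A"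
    and D: "D \<in> carrier_mat n n" and n: "n > 0"
  shows "kth_eigenvalue 1 I + kth_eigenvalue (2 * n) I \<le> 2 * kth_eigenvalue 1 A"
proof -
  have I: "I \<in> carrier_mat (2 * n) (2 * n)"
    using four_block_carrier_mat[OF A A, of D "transpose_mat D"] by (simp add: I_def mult_2)
  have symI: "transpose_mat I = I"
    unfolding I_def using A D symA by (subst transpose_four_block_mat[OF A D _ A]) auto
  let ?a = "kth_eigenvalue 1 I" and ?b = "kth_eigenvalue (2 * n) I" and ?l = "kth_eigenvalue 1 A"
  obtain z where z: "z \<in> carrier_vec (n + n)" "z \<noteq> 0\<^sub>v (n + n)" "I *\<^sub>v z = ?a \<cdot>\<^sub>v z"
    using first_eigenvalue_is_eigenvalue[OF I symI] I n
    by (auto simp: eigenvalue_def eigenvector_def mult_2)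
  define x y where "x = vec_first z n" and "y = vec_last z n"
  have x: "x \<in> carrier_vec n" and y: "y \<in> carrier_vec n"
    by (simp_all add: x_def y_def)
  have zxy: "z = x @\<^sub>v y"
    using z(1) by (simp add: x_def y_def)
  let ?s = "x \<bullet> x + y \<bullet> y" and ?q = "x \<bullet> (A *\<^sub>v x) + y \<bullet> (A *\<^sub>v y)"
  have zz: "z \<bullet> z = ?s"
    using x y by (simp add: zxy scalar_prod_append[of _ n _ n])
  have "?a * ?s = z \<bullet> (I *\<^sub>v z)"
    using z(1) by (simp add: z(3) zz)
  also have "\<dots> = ?q + 2 * (x \<bullet> (D *\<^sub>v y))"
    unfolding zxy I_def by (rule block_quadratic_form[OF A D x y])
  finally have top: "?a * ?s = ?q + 2 * (x \<bullet> (D *\<^sub>v y))" .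
  have my: "- y \<in> carrier_vec n" using y by simp
  have neg: "B *\<^sub>v (- y) = - (B *\<^sub>v y)" if "B \<in> carrier_mat n n" for B :: "real mat"
    using that y by (intro eq_vecI) auto
  have "?b * ((x @\<^sub>v - y) \<bullet> (x @\<^sub>v - y)) \<le> (x @\<^sub>v - y) \<bullet> (I *\<^sub>v (x @\<^sub>v - y))"
    using x my n append_carrier_vec[OF x my]
    by (intro last_eigenvalue_le_rayleigh[OF I symI]) (auto simp: mult_2)
  also have "(x @\<^sub>v - y) \<bullet> (x @\<^sub>v - y) = ?s"
    using x y my by (simp add: scalar_prod_append[of _ n _ n])
  also have "(x @\<^sub>v - y) \<bullet> (I *\<^sub>v (x @\<^sub>v - y)) = ?q - 2 * (x \<bullet> (D *\<^sub>v y))"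
    unfolding I_def block_quadratic_form[OF A D x my] using A D x y by (simp add: neg)
  finally have bottom: "?b * ?s \<le> ?q - 2 * (x \<bullet> (D *\<^sub>v y))" .
  have "?q \<le> ?l * ?s"
    using rayleigh_le_first_eigenvalue[OF A symA x n] rayleigh_le_first_eigenvalue[OF A symA y n]
    by (simp add: distrib_left)
  then have "(?a + ?b) * ?s \<le> (2 * ?l) * ?s"
    using top bottom by (simp add: distrib_right)
  moreover have "?s > 0"
    using scalar_prod_self_pos[OF z(1,2)] zz by simp
  ultimately show ?thesis
    by (rule mult_right_le_imp_le)
qed

theorem theorem8p3:
  fixes G :: "('v, 'e, 'a) mixed_graph" and vs :: "'v list" and n :: nat
  assumes "mixed_graph G"
    and "vertex_enumeration G vs"
    and "n = card (verts G)"
  shows "(1 / 2) * (kth_eigenvalue 1 (integrated_adjacency_matrix G vs)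
            + kth_eigenvalue (2 * n) (integrated_adjacency_matrix G vs))
         \<le> kth_eigenvalue 1 (adjacency_matrix (undirected_part G) vs)"
proof -
  interpret mixed_graph G by fact
  have len: "length vs = n"
    using assms(2,3) distinct_card by (force simp: vertex_enumeration_def)
  have n: "n > 0"
    using assms(3) finite_verts verts_nonempty by (simp add: card_gt_0_iff)
  let ?A = "adjacency_matrix (undirected_part G) vs"
  have A: "?A \<in> carrier_mat n n" and D: "arc_matrix G vs \<in> carrier_mat n n"
    by (simp_all add: adjacency_matrix_def arc_matrix_def len)
  have "transpose_mat ?A = ?A"
    by (rule eq_matI) (auto simp: adjacency_matrix_def insert_commute)
  from block_extreme_eigenvalues_sum_le[OF A this D n] show ?thesis
    by (simp add: integrated_adjacency_matrix_def Let_def)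
qed

end
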